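(* Let $E\subset\mathbb{R}^d$ be bounded with $\operatorname{diam}E>0$ and let $0<m<1/2$. Let $(\epsilon_n)_{n\ge1}$ satisfy $1/n\le\epsilon_n\le1$ for every $n$, and for each $n$ let $\mathcal{M}_n$ be an arbitrary $\epsilon_n$-DP mechanism which assigns to each data set $D\in E^n$ a random persistence diagram $\mathcal{M}_n(D)$. Then it is not possible that $$d_B\big(\mathcal{P}_0(D_n),\mathcal{M}_n(D_n)\big)=o_p\Big(\frac{1}{n\epsilon_n}\Big)\qquad(n\to\infty)$$ for every sequence of data sets $(D_n)_{n\ge 1}$ with $D_n\in E^n$.
   Context: Data sets of size $n$ are $n$-tuples $D=(x_1,\dots,x_n)\in E^n$ (repetitions allowed); $H(D,D')$ is the Hamming distance (the number of entries in which they differ). A mechanism $\mathcal M$ (a random element $\mathcal M(D)$ of an output space $\mathcal Y$ for each $D\in E^n$) is $\epsilon$-DP if $\mathbb P(\mathcal M(D)\in S)\le e^\epsilon\,\mathbb P(\mathcal M(D')\in S)$ for all measurable $S\subseteq\mathcal Y$ and all $D,D'$ with $H(D,D')\le1$. Here $\mathcal Y$ is the space of persistence diagrams with the bottleneck distance. Empirical $L^1$-DTM at resolution $m$: with $k=\lceil mn\rceil$, $\delta_D(x)=\frac1k\sum_{x_i\in N_k(x)}\|x_i-x\|$ for $x\in\mathbb{R}^d$, where $N_k(x)$ is the set of $k$ nearest neighbours of $x$ among $x_1,\dots,x_n$ (with multiplicity) and $\|\cdot\|$ is the Euclidean norm. $\mathcal P_0(D)$ is the $0$th persistence diagram (homology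 with field coefficients) of the sub-level set filtration $\{x\in\mathbb{R}^d:\delta_D(x)\le r\}_{r\in\mathbb{R}}$, a multiset of birth-death pairs $(b,d)$ with $0\le b\le d\le\infty$. Bottleneck distance: $d_B(\mathcal P,\mathcal P')=\min_g\max_z\|z-g(z)\|_\infty$, where $g$ ranges over bijections between $\mathcal P$ and $\mathcal P'$, each augmented with all points of the diagonal (with infinite multiplicity), $z$ ranges over the augmented $\mathcal P$, and by convention $|\infty-\infty|=0$. $X_n=o_p(a_n)$ means $X_n/a_n\to0$ in probability. *)

theory Defs
  imports "HOL-Probability.Probability" "HOL-Homology.Homology"
begin

section \<open>Singular homology with field coefficients\<close>

definition chain_scale :: "'f::field \<Rightarrow> ('s \<Rightarrow>\<^sub>0 'f) \<Rightarrow> ('s \<Rightarrow>\<^sub>0 'f)" where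
  "chain_scale a c = Poly_Mapping.map ((*) a) c"

lemma lookup_chain_scale [simp]:
  "Poly_Mapping.lookup (chain_scale a c) s = a * Poly_Mapping.lookup c s"
  by (simp add: chain_scale_def Poly_Mapping.map.rep_eq when_def)

interpretation chain_vs: vector_space chain_scale
  by unfold_locales (auto intro!: poly_mapping_eqI simp: lookup_add algebra_simps)

type_synonym ('a, 'f) field_chain = "((nat \<Rightarrow> real) \<Rightarrow> 'a) \<Rightarrow>\<^sub>0 'f"

definition field_chains :: "nat \<Rightarrow> 'a topology \<Rightarrow> ('a, 'f::field) field_chain set" where
  "field_chains p X = {c. Poly_Mapping.keys c \<subseteq> singular_simplex_set p X}"

definition field_boundary :: "nat \<Rightarrow> ('a, 'f::field) field_chain \<Rightarrow> ('a, 'f) field_chain" where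
  "field_boundary p c =
     (if p = 0 then 0
      else \<Sum>\<sigma>\<in>Poly_Mapping.keys c. \<Sum>k\<le>p.
             Poly_Mapping.single (singular_face p k \<sigma>) ((-1) ^ k * Poly_Mapping.lookup c \<sigma>))"

definition field_cycles :: "nat \<Rightarrow> 'a topology \<Rightarrow> ('a, 'f::field) field_chain set" where
  "field_cycles p X = {c \<in> field_chains p X. field_boundary p c = 0}"

definition field_boundaries :: "nat \<Rightarrow> 'a topology \<Rightarrow> ('a, 'f::field) field_chain set" where
  "field_boundaries p X = field_boundary (Suc p) ` field_chains (Suc p) X"

text \<open>
  The classes modulo \<open>W\<close> of the vectors in \<open>B\<close> form a basis of the quotient \<open>(U + W) / W\<close>
  (for subspaces \<open>U\<close> and \<open>W\<close>), and \<open>B\<close> contains one vector of each such class.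
\<close>
definition basis_mod ::
  "('s \<Rightarrow>\<^sub>0 'f::field) set \<Rightarrow> ('s \<Rightarrow>\<^sub>0 'f) set \<Rightarrow> ('s \<Rightarrow>\<^sub>0 'f) set \<Rightarrow> bool" where
  "basis_mod U W B \<longleftrightarrow>
     B \<subseteq> U \<and> chain_vs.independent B \<and> chain_vs.span B \<inter> W = {0} \<and> U \<subseteq> chain_vs.span (B \<union> W)"

text \<open>
  The dimension of \<open>(U + W) / W\<close>. All finite bases have the same cardinality, so the infimum
  only serves to select it; it is \<open>\<infinity>\<close> if there is no finite basis.
\<close>
definition dim_mod :: "('s \<Rightarrow>\<^sub>0 'f::field) set \<Rightarrow> ('s \<Rightarrow>\<^sub>0 'f) set \<Rightarrow> enat" where
  "dim_mod U W = (INF B \<in> {B. finite B \<and> basis_mod U W B}. enat (card B))"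

text \<open>
  For \<open>X \<subseteq> Y\<close>, the rank of the map \<open>H\<^sub>p(X; 'f) \<rightarrow> H\<^sub>p(Y; 'f)\<close> induced by inclusion: its image is
  \<open>(Z\<^sub>p(X) + B\<^sub>p(Y)) / B\<^sub>p(Y)\<close>. Since singular simplices are plain functions on the standard
  simplex, inclusion of spaces induces inclusion of chains.
\<close>
definition homology_rank ::
  "'f::field itself \<Rightarrow> nat \<Rightarrow> 'a::topological_space set \<Rightarrow> 'a set \<Rightarrow> enat" where
  "homology_rank _ p X Y =
     dim_mod (field_cycles p (top_of_set X) :: ('a, 'f) field_chain set)
             (field_boundaries p (top_of_set Y))"


section \<open>Persistence diagrams\<close>

text \<open>
  A persistence diagram is given by the multiplicities of its birth-death pairs; infinitely many
  pairs and infinite multiplicities are permitted.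
\<close>
type_synonym diagram = "real \<times> ereal \<Rightarrow> enat"

definition diagrams :: "diagram set" where
  "diagrams = {P. \<forall>b d. P (b, d) \<noteq> 0 \<longrightarrow> 0 \<le> b \<and> ereal b \<le> d}"

text \<open>
  The rank function of the persistence module \<open>r \<mapsto> H\<^sub>p(F r)\<close> of a filtration \<open>F\<close>, extended by
  zero spaces at \<open>-\<infinity>\<close> and \<open>\<infinity>\<close>.
\<close>
definition persistence_rank ::
  "'f::field itself \<Rightarrow> nat \<Rightarrow> (real \<Rightarrow> 'a::topological_space set) \<Rightarrow> ereal \<Rightarrow> ereal \<Rightarrow> enat" where
  "persistence_rank K p F r s =
     (if r = -\<infinity> \<or> s = \<infinity> then 0
      else homology_rank K p (F (real_of_ereal r)) (F (real_of_ereal s)))"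

text \<open>
  The number of classes with birth in \<open>[a\<^sub>1, a\<^sub>2]\<close> and death in \<open>[c\<^sub>1, c\<^sub>2]\<close>, by
  inclusion-exclusion on ranks. If the ranks involved are finite, as for the filtrations
  considered below, then none of the three subtractions truncates.
\<close>
definition rectangle_measure ::
  "'f::field itself \<Rightarrow> nat \<Rightarrow> (real \<Rightarrow> 'a::topological_space set) \<Rightarrow>
   ereal \<Rightarrow> ereal \<Rightarrow> ereal \<Rightarrow> ereal \<Rightarrow> enat" where
  "rectangle_measure K p F a1 a2 c1 c2 =
     (persistence_rank K p F a2 c1 - persistence_rank K p F a1 c1)
     - (persistence_rank K p F a2 c2 - persistence_rank K p F a1 c2)"

text \<open>
  The (undecorated) persistence diagram in the sense of Chazal, de Silva, Glisse and Oudot: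
  the multiplicity of a point is the minimal measure of a rectangle containing it in its
  interior, where \<open>[c\<^sub>1, \<infinity>]\<close> is a neighbourhood of \<open>\<infinity>\<close>. Points on the diagonal carry no information.
\<close>
definition persistence_diagram ::
  "'f::field itself \<Rightarrow> nat \<Rightarrow> (real \<Rightarrow> 'a::topological_space set) \<Rightarrow> diagram" where
  "persistence_diagram K p F = (\<lambda>(b, d).
     if ereal b < d then
       Inf {rectangle_measure K p F a1 a2 c1 c2 | a1 a2 c1 c2.
              a1 < ereal b \<and> ereal b < a2 \<and> a2 < c1 \<and> c1 < d \<and> (d < c2 \<or> d = \<infinity> \<and> c2 = \<infinity>)}
     else 0)"


section \<open>Bottleneck distance\<close>

text \<open>In \<^typ>\<open>ereal\<close>, \<open>\<infinity> - \<infinity> = \<infinity>\<close>; here it has to be \<open>0\<close>.\<close>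
definition ereal_dist :: "ereal \<Rightarrow> ereal \<Rightarrow> ereal" where
  "ereal_dist x y = (if x = y then 0 else \<bar>x - y\<bar>)"

definition point_dist :: "real \<times> ereal \<Rightarrow> real \<times> ereal \<Rightarrow> ereal" where
  "point_dist z w = max (ereal \<bar>fst z - fst w\<bar>) (ereal_dist (snd z) (snd w))"

text \<open>
  A multiset as a set of tagged points, after adding all points of the diagonal with (countably)
  infinite multiplicity.
\<close>
definition augmented :: "diagram \<Rightarrow> ((real \<times> ereal) \<times> nat) set" where
  "augmented P = {(z, i). snd z = ereal (fst z) \<or> enat i < P z}"

definition bottleneck :: "diagram \<Rightarrow> diagram \<Rightarrow> ereal" where
  "bottleneck P Q =
     (INF g \<in> {g. bij_betw g (augmented P) (augmented Q)}.
        SUP z \<in> augmented P. point_dist (fst z) (fst (g z)))"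

text \<open>The Borel sigma-algebra of the (extended pseudo-metric) space of diagrams.\<close>
definition diagram_open :: "diagram set \<Rightarrow> bool" where
  "diagram_open U \<longleftrightarrow>
     U \<subseteq> diagrams \<and> (\<forall>P\<in>U. \<exists>e>0. \<forall>Q\<in>diagrams. bottleneck P Q < ereal e \<longrightarrow> Q \<in> U)"

definition diagram_borel :: "diagram measure" where
  "diagram_borel = sigma diagrams {U. diagram_open U}"


section \<open>Data sets and the empirical distance to measure\<close>

definition datasets :: "nat \<Rightarrow> 'x set \<Rightarrow> 'x list set" where
  "datasets n E = {D. length D = n \<and> set D \<subseteq> E}"

definition hamming :: "'x list \<Rightarrow> 'x list \<Rightarrow> nat" where
  "hamming D D' = card {i. i < length D \<and> D ! i \<noteq> D' ! i}"

text \<open>The sort is stable, so ties are broken by position; this does not affect \<open>dtm\<close>.\<close>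
definition nearest_neighbours :: "'a::real_normed_vector list \<Rightarrow> nat \<Rightarrow> 'a \<Rightarrow> 'a list" where
  "nearest_neighbours D k x = take k (sort_key (\<lambda>y. norm (y - x)) D)"

definition dtm :: "real \<Rightarrow> 'a::real_normed_vector list \<Rightarrow> 'a \<Rightarrow> real" where
  "dtm m D x =
     (let k = nat \<lceil>m * real (length D)\<rceil>
      in (1 / real k) * (\<Sum>y\<leftarrow>nearest_neighbours D k x. norm (y - x)))"

definition dtm_diagram ::
  "'f::field itself \<Rightarrow> nat \<Rightarrow> real \<Rightarrow> 'a::real_normed_vector list \<Rightarrow> diagram" where
  "dtm_diagram K p m D = persistence_diagram K p (\<lambda>r. {x. dtm m D x \<le> r})"


section \<open>Differential privacy and convergence in probability\<close>

text \<open>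
  A mechanism on data sets of size \<open>n\<close>: for each \<open>D\<close> a random element \<open>M D\<close> of \<open>Y\<close>, defined on a
  probability space \<open>\<Omega> D\<close>.
\<close>
definition mechanism ::
  "'x set \<Rightarrow> nat \<Rightarrow> 'y measure \<Rightarrow> ('x list \<Rightarrow> 'w measure) \<Rightarrow> ('x list \<Rightarrow> 'w \<Rightarrow> 'y) \<Rightarrow> bool" where
  "mechanism E n Y \<Omega> M \<longleftrightarrow>
     (\<forall>D\<in>datasets n E. prob_space (\<Omega> D) \<and> M D \<in> measurable (\<Omega> D) Y)"

definition differentially_private ::
  "real \<Rightarrow> 'x set \<Rightarrow> nat \<Rightarrow> 'y measure \<Rightarrow> ('x list \<Rightarrow> 'w measure) \<Rightarrow> ('x list \<Rightarrow> 'w \<Rightarrow> 'y) \<Rightarrow> bool" where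
  "differentially_private \<epsilon> E n Y \<Omega> M \<longleftrightarrow>
     (\<forall>D\<in>datasets n E. \<forall>D'\<in>datasets n E. hamming D D' \<le> 1 \<longrightarrow>
        (\<forall>S\<in>sets Y. measure (\<Omega> D) {\<omega> \<in> space (\<Omega> D). M D \<omega> \<in> S}
                     \<le> exp \<epsilon> * measure (\<Omega> D') {\<omega> \<in> space (\<Omega> D'). M D' \<omega> \<in> S}))"

text \<open>\<open>X\<^sub>n = o\<^sub>p(a\<^sub>n)\<close>, with \<open>X\<^sub>n\<close> defined on \<open>\<Omega>\<^sub>n\<close>.\<close>
definition small_op ::
  "(nat \<Rightarrow> 'w measure) \<Rightarrow> (nat \<Rightarrow> 'w \<Rightarrow> ereal) \<Rightarrow> (nat \<Rightarrow> real) \<Rightarrow> bool" where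
  "small_op \<Omega> X a \<longleftrightarrow>
     (\<forall>\<eta>>0. (\<lambda>n. measure (\<Omega> n) {\<omega> \<in> space (\<Omega> n). \<bar>X n \<omega> / ereal (a n)\<bar> > ereal \<eta>})
              \<longlonglongrightarrow> 0)"

end

theory Submission
  imports Defs
begin

text \<open>
  Fix \<open>x \<noteq> y\<close> in \<open>E\<close>, put \<open>a = dist x y\<close> and \<open>k = \<lceil>mn\<rceil>\<close>, and consider the data set with \<open>j\<close> copies of
  \<open>x\<close> and \<open>n - j\<close> copies of \<open>y\<close>, where \<open>5k/6 \<le> j \<le> k\<close>. The sublevel sets of its distance to
  measure consist of a part around \<open>y\<close>, present from level \<open>0\<close> on, and a part around \<open>x\<close>, which
  appears at level \<open>(k - j) a / k\<close> and merges with the first one at level \<open>a / 2\<close>. Hence the diagrams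
  for \<open>j = k\<close> and \<open>j = k - l\<close> are at bottleneck distance at least \<open>l a / k\<close>, of order
  \<open>1 / (n \<epsilon>\<^sub>n)\<close> if \<open>l\<close> is of order \<open>1 / \<epsilon>\<^sub>n\<close>. The two data sets differ in \<open>l\<close> entries, so
  the laws of the outputs of the mechanism differ at most by the bounded factor \<open>exp (l \<epsilon>\<^sub>n)\<close>, and
  the output cannot be close to both diagrams with high probability.
\<close>

section \<open>Zeroth homology and path components\<close>

abbreviation simplex_vertex :: "nat \<Rightarrow> nat \<Rightarrow> real" where
  "simplex_vertex i \<equiv> (\<lambda>j. if j = i then 1 else 0)"

text \<open>The constant map is restricted because singular simplices must be extensional on the
  standard simplex.\<close>

definition point_simplex :: "'a \<Rightarrow> (nat \<Rightarrow> real) \<Rightarrow> 'a" where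
  "point_simplex a = restrict (\<lambda>_. a) (standard_simplex 0)"

lemma point_simplex_vertex [simp]: "point_simplex a (simplex_vertex 0) = a"
  by (simp add: point_simplex_def)

lemma point_simplex_eq_iff [simp]: "point_simplex a = point_simplex b \<longleftrightarrow> a = b"
  by (metis point_simplex_vertex)

lemma singular_simplex_0_iff:
  "singular_simplex 0 (top_of_set X) \<sigma> \<longleftrightarrow> (\<exists>a\<in>X. \<sigma> = point_simplex a)"
proof
  assume \<sigma>: "singular_simplex 0 (top_of_set X) \<sigma>"
  then have "\<sigma> (simplex_vertex 0) \<in> X"
    by (auto simp: singular_simplex_subtopology standard_simplex_0)
  moreover have "\<sigma> = point_simplex (\<sigma> (simplex_vertex 0))"
  proof (rule extensionalityI[of _ "standard_simplex 0"])
    show "\<sigma> \<in> extensional (standard_simplex 0)"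
      using \<sigma> by (simp add: singular_simplex_def)
    show "point_simplex (\<sigma> (simplex_vertex 0)) \<in> extensional (standard_simplex 0)"
      by (simp add: point_simplex_def)
  qed (auto simp: standard_simplex_0)
  ultimately show "\<exists>a\<in>X. \<sigma> = point_simplex a" by blast
next
  assume "\<exists>a\<in>X. \<sigma> = point_simplex a"
  then obtain a where a: "a \<in> X" "\<sigma> = point_simplex a" by blast
  have "continuous_map (subtopology (powertop_real UNIV) (standard_simplex 0)) (top_of_set X) \<sigma>"
    by (rule continuous_map_eq[of _ _ "\<lambda>_. a"]) (use a in \<open>auto simp: point_simplex_def\<close>)
  then show "singular_simplex 0 (top_of_set X) \<sigma>"
    by (simp add: singular_simplex_def a(2)) (simp add: point_simplex_def)
qed

section \<open>Linear maps on chains, determined by their values on simplices\<close>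

definition chain_extend :: "('s \<Rightarrow> ('t \<Rightarrow>\<^sub>0 'f::field)) \<Rightarrow> ('s \<Rightarrow>\<^sub>0 'f) \<Rightarrow> ('t \<Rightarrow>\<^sub>0 'f)" where
  "chain_extend h c = (\<Sum>\<sigma>\<in>Poly_Mapping.keys c. chain_scale (Poly_Mapping.lookup c \<sigma>) (h \<sigma>))"

lemma chain_scale_single [simp]:
  "chain_scale a (Poly_Mapping.single s b) = Poly_Mapping.single s (a * b)"
  by (rule poly_mapping_eqI) (simp add: lookup_single when_def)

text \<open>Indices outside the support contribute 0. The larger index set avoids case distinctions
  when scaling by 0 shrinks the support.\<close>

lemma chain_extend_superset:
  assumes "finite K" "Poly_Mapping.keys c \<subseteq> K"
  shows "chain_extend h c = (\<Sum>\<sigma>\<in>K. chain_scale (Poly_Mapping.lookup c \<sigma>) (h \<sigma>))"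
  unfolding chain_extend_def
  by (rule sum.mono_neutral_left) (use assms in \<open>auto simp: in_keys_iff\<close>)

lemma linear_chain_extend:
  fixes h :: "'s \<Rightarrow> ('t \<Rightarrow>\<^sub>0 'f::field)"
  shows "Vector_Spaces.linear chain_scale chain_scale (chain_extend h)"
proof (unfold Vector_Spaces.linear_def module_hom_def module_hom_axioms_def, intro conjI allI)
  fix b c :: "'s \<Rightarrow>\<^sub>0 'f" and r :: 'f
  show "chain_extend h (b + c) = chain_extend h b + chain_extend h c"
    unfolding chain_extend_def
    by (rule setsum_keys_plus_distrib) (simp_all add: chain_vs.scale_left_distrib)
  have "Poly_Mapping.keys (chain_scale r b) \<subseteq> Poly_Mapping.keys b"
    by (auto simp: in_keys_iff)
  then have "chain_extend h (chain_scale r b) =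
      (\<Sum>\<sigma>\<in>Poly_Mapping.keys b. chain_scale (r * Poly_Mapping.lookup b \<sigma>) (h \<sigma>))"
    by (subst chain_extend_superset[of "Poly_Mapping.keys b"]) auto
  then show "chain_extend h (chain_scale r b) = chain_scale r (chain_extend h b)"
    by (simp add: chain_extend_def chain_vs.scale_sum_right)
qed (unfold_locales)

interpretation chain_hom: vector_space_pair
  "chain_scale :: 'f::field \<Rightarrow> ('s \<Rightarrow>\<^sub>0 'f) \<Rightarrow> _" "chain_scale :: 'f \<Rightarrow> ('t \<Rightarrow>\<^sub>0 'f) \<Rightarrow> _"
  by unfold_locales

lemma chain_extend_single [simp]:
  "chain_extend h (Poly_Mapping.single s a) = chain_scale a (h s)"
  by (subst chain_extend_superset[of "{s}"]) auto

lemma chain_eq_sum_single: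
  "c = (\<Sum>\<sigma>\<in>Poly_Mapping.keys c. chain_scale (Poly_Mapping.lookup c \<sigma>) (Poly_Mapping.single \<sigma> 1))"
proof (rule poly_mapping_eqI)
  fix s
  have "Poly_Mapping.lookup
      (\<Sum>\<sigma>\<in>Poly_Mapping.keys c. chain_scale (Poly_Mapping.lookup c \<sigma>) (Poly_Mapping.single \<sigma> 1)) s
      = (\<Sum>\<sigma>\<in>Poly_Mapping.keys c. if \<sigma> = s then Poly_Mapping.lookup c \<sigma> else 0)"
    unfolding lookup_sum by (rule sum.cong) (auto simp: lookup_single when_def)
  also have "\<dots> = Poly_Mapping.lookup c s"
    by (simp add: in_keys_iff)
  finally show "Poly_Mapping.lookup c s = Poly_Mapping.lookup
      (\<Sum>\<sigma>\<in>Poly_Mapping.keys c. chain_scale (Poly_Mapping.lookup c \<sigma>) (Poly_Mapping.single \<sigma> 1)) s"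
    by simp
qed

lemma restrict_singleton: "restrict f {a} = restrict (\<lambda>_. f a) {a}"
  by (rule restrict_ext) simp

lemma singular_face_1:
  "singular_face (Suc 0) 0 \<sigma> = point_simplex (\<sigma> (simplex_vertex 1))"
  "singular_face (Suc 0) (Suc 0) \<sigma> = point_simplex (\<sigma> (simplex_vertex 0))"
proof -
  \<comment> \<open>\<open>simplical_face k\<close> inserts a zero coordinate at position
    \<open>k\<close>, so the face opposite to one vertex of an edge is the other vertex.\<close>
  have "simplical_face 0 (simplex_vertex 0) = simplex_vertex 1"
       "simplical_face (Suc 0) (simplex_vertex 0) = simplex_vertex 0"
    by (auto simp: simplical_face_def fun_eq_iff)
  then show
    "singular_face (Suc 0) 0 \<sigma> = point_simplex (\<sigma> (simplex_vertex 1))"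
    "singular_face (Suc 0) (Suc 0) \<sigma> = point_simplex (\<sigma> (simplex_vertex 0))"
    unfolding singular_face_def point_simplex_def
    by (simp_all add: standard_simplex_0 restrict_singleton[of "\<sigma> \<circ> _"])
qed

text \<open>As the linear extension of end point minus starting point, the boundary can be treated
  edge by edge.\<close>

lemma field_boundary_1:
  "field_boundary (Suc 0) c =
     chain_extend (\<lambda>\<sigma>. Poly_Mapping.single (point_simplex (\<sigma> (simplex_vertex 1))) 1
                      - Poly_Mapping.single (point_simplex (\<sigma> (simplex_vertex 0))) 1) c"
  unfolding field_boundary_def chain_extend_def
  by (auto simp: singular_face_1 chain_vs.scale_right_diff_distrib single_uminus intro!: sum.cong)

text \<open>The standard simplex is path connected, so its continuous image joins the two vertices
  within \<open>X\<close>.\<close>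

lemma singular_1_simplex_path_component:
  fixes X :: "'a::topological_space set"
  assumes "singular_simplex (Suc 0) (top_of_set X) \<sigma>"
  shows "path_component X (\<sigma> (simplex_vertex 0)) (\<sigma> (simplex_vertex 1))"
proof -
  have "path_connectedin (top_of_set X) (\<sigma> ` standard_simplex (Suc 0))"
    using assms unfolding singular_simplex_def
    by (metis path_connectedin_continuous_map_image path_connectedin_standard_simplex
        path_connectedin_subtopology subset_refl)
  then have "path_connected (\<sigma> ` standard_simplex (Suc 0))" "\<sigma> ` standard_simplex (Suc 0) \<subseteq> X"
    by (auto simp: path_connectedin_subtopology)
  then show ?thesis
    using path_component_of_subset[of "\<sigma> ` standard_simplex (Suc 0)" X]
    by (simp add: path_connected_component)
qed

lemma path_component_imp_boundary:
  fixes Y :: "'a::topological_space set"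
  assumes "path_component Y a b"
  shows "Poly_Mapping.single (point_simplex b) 1 - Poly_Mapping.single (point_simplex a) 1
           \<in> (field_boundaries 0 (top_of_set Y) :: ('a, 'f::field) field_chain set)"
proof -
  obtain g :: "real \<Rightarrow> 'a" where g: "continuous_on {0..1} g" "g ` {0..1} \<subseteq> Y" "g 0 = a" "g 1 = b"
    using assms unfolding path_component_def path_def path_image_def pathstart_def pathfinish_def
    by metis
  \<comment> \<open>On the 1-simplex the coordinate \<open>v 1\<close> runs from 0 at vertex 0 to 1
    at vertex 1, so it serves as the parameter of the path.\<close>
  define \<sigma> where "\<sigma> = restrict (\<lambda>v. g (v 1)) (standard_simplex (Suc 0))"
  have coord: "v 1 \<in> {0..1}" if "v \<in> standard_simplex (Suc 0)" for v
    using that by (auto simp: standard_simplex_def)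
  have "continuous_map (subtopology (powertop_real UNIV) (standard_simplex (Suc 0)))
          (top_of_set {0..1::real}) (\<lambda>v. v 1)"
    by (auto simp: continuous_map_in_subtopology coord[simplified]
        intro!: continuous_map_from_subtopology continuous_map_product_projection)
  moreover have "continuous_map (top_of_set {0..1::real}) (top_of_set Y) g"
    using g by (auto simp: continuous_map_in_subtopology)
  ultimately have "continuous_map (subtopology (powertop_real UNIV) (standard_simplex (Suc 0)))
          (top_of_set Y) (g \<circ> (\<lambda>v. v 1))"
    by (rule continuous_map_compose)
  then have "continuous_map (subtopology (powertop_real UNIV) (standard_simplex (Suc 0)))
          (top_of_set Y) \<sigma>"
    by (rule continuous_map_eq) (simp add: \<sigma>_def)
  then have "singular_simplex (Suc 0) (top_of_set Y) \<sigma>"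
    by (simp add: singular_simplex_def \<sigma>_def)
  then have "(Poly_Mapping.single \<sigma> 1 :: ('a, 'f) field_chain) \<in> field_chains (Suc 0) (top_of_set Y)"
    by (simp add: field_chains_def)
  moreover have "field_boundary (Suc 0) (Poly_Mapping.single \<sigma> 1 :: ('a, 'f) field_chain)
      = Poly_Mapping.single (point_simplex b) 1 - Poly_Mapping.single (point_simplex a) 1"
    using g by (simp add: field_boundary_1 \<sigma>_def)
  ultimately show ?thesis
    unfolding field_boundaries_def by (metis image_eqI)
qed

text \<open>\<open>S\<close> is a transversal of the path components of \<open>Y\<close> that meet
  \<open>X\<close>. By \<open>reach\<close> its points generate the 0-cycles of \<open>X\<close>
  modulo the boundaries in \<open>Y\<close>, and by \<open>sep\<close> they are independent modulo
  these.\<close>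

lemma homology_rank_0_eq_card:
  fixes X Y S :: "'a::topological_space set"
  assumes fin: "finite S" and SX: "S \<subseteq> X" and XY: "X \<subseteq> Y"
    and reach: "\<And>x. x \<in> X \<Longrightarrow> \<exists>s\<in>S. path_component Y x s"
    and sep: "\<And>s t. s \<in> S \<Longrightarrow> t \<in> S \<Longrightarrow> path_component Y s t \<Longrightarrow> s = t"
  shows "homology_rank TYPE('f::field) 0 X Y = enat (card S)"
proof -
  define e :: "'a \<Rightarrow> ('a, 'f) field_chain" where
    "e a = Poly_Mapping.single (point_simplex a) 1" for a
  define U :: "('a, 'f) field_chain set" where "U = field_cycles 0 (top_of_set X)"
  define W :: "('a, 'f) field_chain set" where "W = field_boundaries 0 (top_of_set Y)"
  define rep where "rep a = (SOME s. s \<in> S \<and> path_component Y a s)" for a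
  define h :: "((nat \<Rightarrow> real) \<Rightarrow> 'a) \<Rightarrow> ('a, 'f) field_chain" where
    "h \<sigma> = (if \<exists>s\<in>S. path_component Y (\<sigma> (simplex_vertex 0)) s
            then e (rep (\<sigma> (simplex_vertex 0))) else 0)" for \<sigma>
  \<comment> \<open>\<open>\<phi>\<close> vanishes on \<open>W\<close> and fixes \<open>e ` S\<close>, so it turns linear algebra modulo \<open>W\<close> into linear
    algebra in the span of \<open>e ` S\<close>.\<close>
  define \<phi> where "\<phi> = chain_extend h"
  have lin: "Vector_Spaces.linear chain_scale chain_scale \<phi>"
    unfolding \<phi>_def by (rule linear_chain_extend)
  have rep: "rep a \<in> S \<and> path_component Y a (rep a)" if "\<exists>s\<in>S. path_component Y a s" for a
    unfolding rep_def by (rule someI_ex) (use that in blast)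
  have h_cong: "h (point_simplex a) = h (point_simplex b)" if "path_component Y a b" for a b
  proof -
    \<comment> \<open>The choice in \<open>rep\<close> depends on its argument only through this
      predicate, so one component has one representative.\<close>
    have "path_component Y a s \<longleftrightarrow> path_component Y b s" for s
      using that by (meson path_component_sym path_component_trans)
    then show ?thesis by (simp add: h_def rep_def)
  qed
  have \<phi>_e: "\<phi> (e s) = e s" if "s \<in> S" for s
  proof -
    have "path_component Y s s"
      using that SX XY by (auto intro: path_component_refl)
    then have ex: "\<exists>t\<in>S. path_component Y s t"
      using that by (intro bexI[of _ s])
    have "rep s = s"
      using rep[OF ex] sep[OF that, of "rep s"] by simp
    then show ?thesis
      using ex by (simp add: \<phi>_def e_def h_def)
  qed
  have \<phi>_W: "\<phi> w = 0" if wW: "w \<in> W" for w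
  proof -
    obtain c :: "('a, 'f) field_chain" where "c \<in> field_chains (Suc 0) (top_of_set Y)"
      and w: "w = field_boundary (Suc 0) c"
      using wW unfolding W_def field_boundaries_def by blast
    then have c: "Poly_Mapping.keys c \<subseteq> singular_simplex_set (Suc 0) (top_of_set Y)"
      by (simp add: field_chains_def)
    have "\<phi> w = (\<Sum>\<sigma>\<in>Poly_Mapping.keys c. chain_scale (Poly_Mapping.lookup c \<sigma>)
           (h (point_simplex (\<sigma> (simplex_vertex 1))) - h (point_simplex (\<sigma> (simplex_vertex 0)))))"
      unfolding w field_boundary_1 chain_extend_def[of _ c]
      by (simp add: chain_hom.linear_sum[OF lin] chain_hom.linear_scale[OF lin]
          chain_hom.linear_diff[OF lin]) (simp add: \<phi>_def)
    also have "\<dots> = 0"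
    proof (rule sum.neutral, rule ballI)
      fix \<sigma> assume "\<sigma> \<in> Poly_Mapping.keys c"
      then have "path_component Y (\<sigma> (simplex_vertex 0)) (\<sigma> (simplex_vertex 1))"
        using c singular_1_simplex_path_component by blast
      from h_cong[OF this] show "chain_scale (Poly_Mapping.lookup c \<sigma>)
           (h (point_simplex (\<sigma> (simplex_vertex 1))) - h (point_simplex (\<sigma> (simplex_vertex 0)))) = 0"
        by simp
    qed
    finally show ?thesis .
  qed
  have inj: "inj_on e S"
    by (rule inj_onI) (metis e_def one_neq_zero keys_single point_simplex_eq_iff singleton_inject)
  have card_e: "card (e ` S) = card S"
    by (rule card_image[OF inj])
  have indep: "chain_vs.independent (e ` S)"
  proof
    assume "chain_vs.dependent (e ` S)"
    then obtain u where u: "\<exists>v\<in>e ` S. u v \<noteq> 0" "(\<Sum>v\<in>e ` S. chain_scale (u v) v) = 0"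
      using chain_vs.dependent_finite[of "e ` S"] fin by auto
    then obtain s where s: "s \<in> S" "u (e s) \<noteq> 0" by blast
    \<comment> \<open>The coefficient at the simplex of \<open>s\<close> isolates
      \<open>u (e s)\<close>, since distinct points give distinct simplices.\<close>
    have "0 = Poly_Mapping.lookup (\<Sum>v\<in>e ` S. chain_scale (u v) v) (point_simplex s)"
      by (simp add: u(2))
    also have "\<dots> = (\<Sum>t\<in>S. u (e t) * Poly_Mapping.lookup (e t) (point_simplex s))"
      by (simp add: sum.reindex[OF inj] lookup_sum)
    also have "\<dots> = (\<Sum>t\<in>S. if t = s then u (e t) else 0)"
      by (rule sum.cong) (auto simp: e_def lookup_single when_def)
    also have "\<dots> = u (e s)"
      using s fin by simp
    finally show False using s by simp
  qed
  have e_U: "e ` S \<subseteq> U"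
    using SX by (auto simp: U_def field_cycles_def field_chains_def field_boundary_def e_def
        singular_simplex_0_iff)
  have \<phi>_span: "\<phi> v = v" if "v \<in> chain_vs.span (e ` S)" for v
    using that
  proof (induction rule: chain_vs.span_induct_alt)
    case base
    show ?case by (rule chain_hom.linear_0[OF lin])
  next
    case (step c x y)
    then show ?case
      using \<phi>_e by (auto simp: chain_hom.linear_add[OF lin] chain_hom.linear_scale[OF lin])
  qed
  have "0 \<in> W"
    unfolding W_def field_boundaries_def
    by (rule image_eqI[of _ _ 0]) (auto simp: field_boundary_def field_chains_def)
  \<comment> \<open>A vector in the intersection is both fixed by \<open>\<phi>\<close> and sent to
    0.\<close>
  then have inter: "chain_vs.span (e ` S) \<inter> W = {0}"
    using \<phi>_span \<phi>_W chain_vs.span_zero by force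
  have span: "U \<subseteq> chain_vs.span (e ` S \<union> W)"
  proof
    fix c assume "c \<in> U"
    then have c: "Poly_Mapping.keys c \<subseteq> singular_simplex_set 0 (top_of_set X)"
      by (simp add: U_def field_cycles_def field_chains_def)
    have "Poly_Mapping.single \<sigma> 1 \<in> chain_vs.span (e ` S \<union> W)"
      if \<sigma>: "\<sigma> \<in> Poly_Mapping.keys c" for \<sigma>
    proof -
      have "singular_simplex 0 (top_of_set X) \<sigma>"
        using \<sigma> c by blast
      then obtain a where a: "a \<in> X" "\<sigma> = point_simplex a"
        unfolding singular_simplex_0_iff by blast
      obtain s where s: "s \<in> S" "path_component Y s a"
        using reach[OF a(1)] path_component_sym by blast
      \<comment> \<open>A path from \<open>s\<close> to \<open>a\<close>, read as an edge, has this
        difference as its boundary.\<close>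
      have "e a - e s \<in> W"
        using path_component_imp_boundary[OF s(2)] by (simp add: e_def W_def)
      then have "(e a - e s) + e s \<in> chain_vs.span (e ` S \<union> W)"
        using s(1) by (intro chain_vs.span_add chain_vs.span_base) auto
      then show ?thesis by (simp add: e_def a(2))
    qed
    then show "c \<in> chain_vs.span (e ` S \<union> W)"
      by (subst chain_eq_sum_single[of c]) (intro chain_vs.span_sum chain_vs.span_scale)
  qed
  have basis: "basis_mod U W (e ` S)"
    unfolding basis_mod_def using e_U indep inter span by blast
  have minimal: "card S \<le> card B" if B: "finite B" "basis_mod U W B" for B
  proof -
    have "e ` S \<subseteq> \<phi> ` (chain_vs.span (B \<union> W))"
    proof
      fix v assume v: "v \<in> e ` S"
      then have "v = \<phi> v" using \<phi>_e by auto
      moreover have "v \<in> chain_vs.span (B \<union> W)"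
        using v e_U B(2) unfolding basis_mod_def by blast
      ultimately show "v \<in> \<phi> ` chain_vs.span (B \<union> W)" by (rule image_eqI)
    qed
    also have "\<dots> = chain_vs.span (\<phi> ` B \<union> \<phi> ` W)"
      by (simp add: chain_hom.linear_span_image[OF lin, symmetric] image_Un)
    also have "\<dots> \<subseteq> chain_vs.span (insert 0 (\<phi> ` B))"
      using \<phi>_W by (intro chain_vs.span_mono) auto
    finally have "e ` S \<subseteq> chain_vs.span (\<phi> ` B)"
      by simp
    then have "card (e ` S) \<le> card (\<phi> ` B)"
      using chain_vs.independent_span_bound[OF _ indep] B(1) by blast
    also have "\<dots> \<le> card B"
      by (rule card_image_le[OF B(1)])
    finally show ?thesis by (simp add: card_e)
  qed
  have "dim_mod U W = enat (card S)"
    unfolding dim_mod_def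
  proof (rule antisym)
    show "(INF B\<in>{B. finite B \<and> basis_mod U W B}. enat (card B)) \<le> enat (card S)"
      by (rule INF_lower2[of "e ` S"]) (use basis fin card_e in auto)
    show "enat (card S) \<le> (INF B\<in>{B. finite B \<and> basis_mod U W B}. enat (card B))"
      by (rule INF_greatest) (use minimal in auto)
  qed
  then show ?thesis
    by (simp add: homology_rank_def U_def W_def)
qed


section \<open>The bottleneck distance\<close>

lemma ereal_dist_commute: "ereal_dist x y = ereal_dist y x"
  by (cases x; cases y) (auto simp: ereal_dist_def)

lemma ereal_dist_triangle: "ereal_dist x z \<le> ereal_dist x y + ereal_dist y z"
  by (cases x; cases y; cases z) (auto simp: ereal_dist_def)

lemma ereal_dist_nonneg: "0 \<le> ereal_dist x y"
  by (simp add: ereal_dist_def)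

lemma point_dist_commute: "point_dist z w = point_dist w z"
  by (simp add: point_dist_def ereal_dist_commute abs_minus_commute)

lemma point_dist_triangle: "point_dist u w \<le> point_dist u v + point_dist v w"
proof -
  have "ereal \<bar>fst u - fst w\<bar> \<le> ereal \<bar>fst u - fst v\<bar> + ereal \<bar>fst v - fst w\<bar>"
    by simp
  also have "\<dots> \<le> point_dist u v + point_dist v w"
    unfolding point_dist_def by (intro add_mono max.cobounded1)
  finally have fst: "ereal \<bar>fst u - fst w\<bar> \<le> point_dist u v + point_dist v w" .
  have "ereal_dist (snd u) (snd w) \<le> ereal_dist (snd u) (snd v) + ereal_dist (snd v) (snd w)"
    by (rule ereal_dist_triangle)
  also have "\<dots> \<le> point_dist u v + point_dist v w"
    unfolding point_dist_def by (intro add_mono max.cobounded2)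
  finally show ?thesis
    using fst by (simp add: point_dist_def[of u w])
qed

text \<open>The infimum over matchings need not be attained; only a strict bound yields an actual
  matching, hence the strict hypotheses below.\<close>

lemma bottleneck_less_iff:
  "bottleneck P Q < c \<longleftrightarrow>
     (\<exists>g. bij_betw g (augmented P) (augmented Q)
        \<and> (SUP z\<in>augmented P. point_dist (fst z) (fst (g z))) < c)"
  by (auto simp: bottleneck_def INF_less_iff)

text \<open>The inverse matching has the same costs.\<close>

lemma bottleneck_less_swap:
  assumes "bottleneck P Q < c"
  shows "bottleneck Q P < c"
proof -
  obtain g where g: "bij_betw g (augmented P) (augmented Q)"
    "(SUP z\<in>augmented P. point_dist (fst z) (fst (g z))) < c"
    using assms unfolding bottleneck_less_iff by blast
  define h where "h = inv_into (augmented P) g"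
  have h: "bij_betw h (augmented Q) (augmented P)"
    unfolding h_def by (rule bij_betw_inv_into[OF g(1)])
  have "(SUP w\<in>augmented Q. point_dist (fst w) (fst (h w)))
      \<le> (SUP z\<in>augmented P. point_dist (fst z) (fst (g z)))"
  proof (rule SUP_least)
    fix w assume w: "w \<in> augmented Q"
    then have "h w \<in> augmented P" "g (h w) = w"
      using h g(1) by (auto simp: h_def bij_betw_inv_into_right dest: bij_betwE)
    then show "point_dist (fst w) (fst (h w)) \<le> (SUP z\<in>augmented P. point_dist (fst z) (fst (g z)))"
      by (metis (no_types, lifting) SUP_upper point_dist_commute)
  qed
  with g(2) h show ?thesis
    unfolding bottleneck_less_iff by (meson le_less_trans)
qed

text \<open>Matchings compose, and the costs along a composition add up at most.\<close>

lemma bottleneck_triangle_less: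
  assumes "bottleneck P Q < a" "bottleneck Q R < b"
  shows "bottleneck P R \<le> a + b"
proof -
  obtain f where f: "bij_betw f (augmented P) (augmented Q)"
    "(SUP z\<in>augmented P. point_dist (fst z) (fst (f z))) < a"
    using assms(1) unfolding bottleneck_less_iff by blast
  obtain g where g: "bij_betw g (augmented Q) (augmented R)"
    "(SUP z\<in>augmented Q. point_dist (fst z) (fst (g z))) < b"
    using assms(2) unfolding bottleneck_less_iff by blast
  have "bottleneck P R \<le> (SUP z\<in>augmented P. point_dist (fst z) (fst ((g \<circ> f) z)))"
    unfolding bottleneck_def by (rule INF_lower) (use f g bij_betw_trans in blast)
  also have "\<dots> \<le> a + b"
  proof (rule SUP_least)
    fix z assume z: "z \<in> augmented P"
    then have fz: "f z \<in> augmented Q" using f(1) by (auto dest: bij_betwE)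
    have "point_dist (fst z) (fst (f z)) \<le> a"
      using z f(2) by (meson SUP_upper le_less_trans less_imp_le)
    moreover have "point_dist (fst (f z)) (fst (g (f z))) \<le> b"
      using fz g(2) by (meson SUP_upper le_less_trans less_imp_le)
    ultimately have "point_dist (fst z) (fst (f z)) + point_dist (fst (f z)) (fst (g (f z))) \<le> a + b"
      by (rule add_mono)
    then show "point_dist (fst z) (fst ((g \<circ> f) z)) \<le> a + b"
      using point_dist_triangle[of "fst z" "fst (g (f z))" "fst (f z)"] by simp
  qed
  finally show ?thesis .
qed

lemma bottleneck_nonneg: "0 \<le> bottleneck P Q"
  unfolding bottleneck_def
proof (rule INF_greatest)
  fix g
  \<comment> \<open>A diagonal point keeps the supremum from being taken over the empty set, where
    it would be \<open>-\<infinity>\<close>.\<close>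
  have "((0, ereal 0), 0) \<in> augmented P"
    by (simp add: augmented_def)
  then have "point_dist (0, ereal 0) (fst (g ((0, ereal 0), 0)))
      \<le> (SUP z\<in>augmented P. point_dist (fst z) (fst (g z)))"
    by (metis (no_types, lifting) SUP_upper fst_conv)
  moreover have "0 \<le> point_dist z w" for z w
    by (simp add: point_dist_def ereal_dist_nonneg le_max_iff_disj)
  ultimately show "0 \<le> (SUP z\<in>augmented P. point_dist (fst z) (fst (g z)))"
    by (meson order_trans)
qed

text \<open>By the triangle inequality the complement of a closed ball is open. This makes the
  events in the privacy argument measurable.\<close>

lemma bottleneck_far_in_sets: "{R \<in> diagrams. bottleneck P R > ereal t} \<in> sets diagram_borel"
proof -
  have "diagram_open {R \<in> diagrams. bottleneck P R > ereal t}"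
    unfolding diagram_open_def
  proof (intro conjI ballI)
    fix R assume "R \<in> {R \<in> diagrams. bottleneck P R > ereal t}"
    then have "ereal t < bottleneck P R" by simp
    \<comment> \<open>The distance may be infinite, so a real \<open>u\<close> below it replaces it.
      A distance to \<open>Q\<close> of at most \<open>t < (u + t) / 2\<close>, plus the radius
      \<open>(u - t) / 2\<close>, would bound the distance to \<open>R\<close> by
      \<open>u\<close>.\<close>
    from ereal_dense2[OF this] obtain u where u: "t < u" "ereal u < bottleneck P R"
      by (auto simp only: less_ereal.simps)
    show "\<exists>e>0. \<forall>Q\<in>diagrams. bottleneck R Q < ereal e \<longrightarrow> Q \<in> {R \<in> diagrams. bottleneck P R > ereal t}"
    proof (intro exI[of _ "(u - t) / 2"] conjI ballI impI)
      fix Q assume Q: "Q \<in> diagrams" "bottleneck R Q < ereal ((u - t) / 2)"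
      have "ereal t < bottleneck P Q"
      proof (rule ccontr)
        assume "\<not> ereal t < bottleneck P Q"
        then have "bottleneck P Q \<le> ereal t" by simp
        also have "ereal t < ereal ((u + t) / 2)" using u(1) by simp
        finally have "bottleneck P Q < ereal ((u + t) / 2)" .
        from bottleneck_triangle_less[OF this bottleneck_less_swap[OF Q(2)]]
        have "bottleneck P R \<le> ereal u" by (simp add: field_simps)
        with u(2) show False by simp
      qed
      with Q(1) show "Q \<in> {R \<in> diagrams. bottleneck P R > ereal t}" by simp
    qed (use u in simp)
  qed auto
  then show ?thesis
    unfolding diagram_borel_def
    by (subst sets_measure_of) (auto simp: diagram_open_def intro!: sigma_sets.Basic)
qed

lemma space_diagram_borel [simp]: "space diagram_borel = diagrams"
  unfolding diagram_borel_def by (rule space_measure_of) (auto simp: diagram_open_def)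

text \<open>A point can be matched to the diagonal only at a cost of at least half its persistence.\<close>

lemma bottleneck_ge_of_missing_birth:
  assumes P: "P (b, ereal d) \<noteq> 0"
    and Q: "\<And>b' d'. Q (b', d') \<noteq> 0 \<Longrightarrow> b' \<le> b - \<delta>"
    and d: "b + 2 * \<delta> \<le> d"
  shows "ereal \<delta> \<le> bottleneck P Q"
  unfolding bottleneck_def
proof (rule INF_greatest)
  fix g assume "g \<in> {g. bij_betw g (augmented P) (augmented Q)}"
  then have g: "bij_betw g (augmented P) (augmented Q)" by simp
  have z: "((b, ereal d), 0) \<in> augmented P"
    using P by (simp add: augmented_def zero_enat_def[symmetric] zero_less_iff_neq_zero)
  obtain b' d' i where w: "g ((b, ereal d), 0) = ((b', d'), i)"
    by (metis prod.exhaust)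
  have "((b', d'), i) \<in> augmented Q"
    using bij_betwE[OF g] z w by metis
  then consider "d' = ereal b'" | "Q (b', d') \<noteq> 0"
    by (auto simp: augmented_def) (metis not_less_zero)
  then have "ereal \<delta> \<le> point_dist (b, ereal d) (b', d')"
  proof cases
    case 1
    have "\<delta> \<le> max \<bar>b - b'\<bar> \<bar>d - b'\<bar>" using d by linarith
    then show ?thesis
      unfolding point_dist_def 1 by (auto simp: ereal_dist_def le_max_iff_disj)
  next
    case 2
    \<comment> \<open>An off-diagonal partner is born at least \<open>\<delta>\<close> earlier, so
      the first coordinate alone costs enough.\<close>
    then have "\<delta> \<le> \<bar>b - b'\<bar>" using Q[of b' d'] by linarith
    then show ?thesis by (simp add: point_dist_def le_max_iff_disj)
  qed
  also have "\<dots> = point_dist (fst ((b, ereal d), 0::nat)) (fst (g ((b, ereal d), 0)))"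
    by (simp add: w)
  also have "\<dots> \<le> (SUP z\<in>augmented P. point_dist (fst z) (fst (g z)))"
    by (rule SUP_upper[OF z])
  finally show "ereal \<delta> \<le> (SUP z\<in>augmented P. point_dist (fst z) (fst (g z)))" .
qed


section \<open>Data sets supported on two points\<close>

text \<open>With \<open>t = 1 - j / k\<close>, this is the distance to measure of \<open>j\<close>
  copies of \<open>x\<close> and sufficiently many copies of \<open>y\<close>. On ties the two
  branches agree.\<close>

definition two_point :: "real \<Rightarrow> 'a::real_normed_vector \<Rightarrow> 'a \<Rightarrow> 'a \<Rightarrow> real" where
  "two_point t x y z =
     (if dist z x \<le> dist z y then (1 - t) * dist z x + t * dist z y else dist z y)"

lemma segment_dist:
  fixes v w z :: "'a::real_normed_vector"
  assumes "w \<in> closed_segment z v"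
  obtains u where "0 \<le> u" "u \<le> 1" "dist w v = (1 - u) * dist z v" "dist w z = u * dist z v"
    "\<And>p. dist w p \<le> (1 - u) * dist z p + u * dist v p"
proof -
  obtain u where u: "0 \<le> u" "u \<le> 1" "w = (1 - u) *\<^sub>R z + u *\<^sub>R v"
    using assms by (auto simp: closed_segment_def)
  have "w - v = (1 - u) *\<^sub>R (z - v)" "w - z = u *\<^sub>R (v - z)"
    by (simp_all add: u(3) algebra_simps)
  then have "dist w v = (1 - u) * dist z v" "dist w z = u * dist z v"
    using u(1,2) by (simp_all add: dist_norm norm_minus_commute[of v z])
  moreover have "dist w p \<le> (1 - u) * dist z p + u * dist v p" for p
  proof -
    have "w - p = (1 - u) *\<^sub>R (z - p) + u *\<^sub>R (v - p)"
      by (simp add: u(3) algebra_simps)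
    then have "norm (w - p) \<le> norm ((1 - u) *\<^sub>R (z - p)) + norm (u *\<^sub>R (v - p))"
      by (metis norm_triangle_ineq)
    then show ?thesis
      using u by (simp add: dist_norm)
  qed
  ultimately show ?thesis using that u by blast
qed

text \<open>The bound \<open>t < 1 / 2\<close> places the birth \<open>t * a\<close> of the part
  around \<open>x\<close> below the merging level \<open>a / 2\<close>.\<close>

locale two_point_sublevels =
  fixes t :: real and x y :: "'a::real_normed_vector" and F :: "real \<Rightarrow> 'a set"
  assumes t: "0 \<le> t" "t < 1 / 2" and distinct: "x \<noteq> y"
  defines "F \<equiv> (\<lambda>r. {z. two_point t x y z \<le> r})"
begin

abbreviation a where "a \<equiv> dist x y"

lemma a_pos: "a > 0" using distinct by simp

lemma F_mono: "r \<le> s \<Longrightarrow> F r \<subseteq> F s" by (auto simp: F_def)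

lemma two_point_nonneg: "0 \<le> two_point t x y z"
  using t by (auto simp: two_point_def)

lemma F_neg: "r < 0 \<Longrightarrow> F r = {}"
  using two_point_nonneg by (auto simp: F_def) (metis not_less order_trans)

lemma y_in: "y \<in> F r \<longleftrightarrow> 0 \<le> r"
  using distinct by (auto simp: F_def two_point_def)

lemma x_in: "x \<in> F r \<longleftrightarrow> t * a \<le> r"
  by (simp add: F_def two_point_def)

text \<open>The point \<open>x\<close> is lowest on its side, by the triangle inequality and
  \<open>t \<le> 1 - t\<close>.\<close>

lemma x_side_ge: "dist z x \<le> dist z y \<Longrightarrow> t * a \<le> two_point t x y z"
proof -
  assume *: "dist z x \<le> dist z y"
  have "t * a \<le> t * (dist z x + dist z y)"
    using t by (intro mult_left_mono) (metis dist_commute dist_triangle, simp)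
  also have "\<dots> = t * dist z x + t * dist z y" by (simp add: algebra_simps)
  also have "\<dots> \<le> (1 - t) * dist z x + t * dist z y"
    using t by (intro add_right_mono mult_right_mono) auto
  finally show ?thesis using * by (simp add: two_point_def)
qed

text \<open>On the bisector the function is the common distance to \<open>x\<close> and
  \<open>y\<close>, at least half of theirs. This is the barrier between the two parts.\<close>

lemma bisector_ge: "dist z x = dist z y \<Longrightarrow> a / 2 \<le> two_point t x y z"
  using dist_triangle2[of x y z] by (simp add: two_point_def algebra_simps dist_commute)

section \<open>Path components of the sublevel sets\<close>

lemma segment_component: "closed_segment p q \<subseteq> F s \<Longrightarrow> path_component (F s) p q"
  using path_component_of_subset[of "closed_segment p q" "F s" p q]
  by (meson convex_closed_segment convex_imp_path_connected ends_in_segment path_connected_component)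

text \<open>The part around \<open>x\<close> is star-shaped: along a segment towards
  \<open>x\<close> the function is at most the interpolation between its value at \<open>z\<close>
  and the smaller value \<open>t * a\<close> at \<open>x\<close>.\<close>

lemma x_side_component:
  assumes "dist z x \<le> dist z y" "z \<in> F s"
  shows "path_component (F s) z x"
proof (rule segment_component, rule subsetI)
  fix w assume "w \<in> closed_segment z x"
  then obtain u where u: "0 \<le> u" "u \<le> 1" "dist w x = (1 - u) * dist z x" "dist w z = u * dist z x"
    and conv: "\<And>p. dist w p \<le> (1 - u) * dist z p + u * dist x p"
    by (rule segment_dist) blast
  \<comment> \<open>Moving towards \<open>x\<close> reduces the distance to \<open>x\<close> by
    exactly the length moved and that to \<open>y\<close> by at most this length, so the segment
    stays on its side.\<close>
  have "dist z y \<le> dist w z + dist w y" by (metis dist_commute dist_triangle)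
  then have "dist w x \<le> dist w y" using assms(1) u by (simp add: algebra_simps)
  then have "two_point t x y w = (1 - t) * ((1 - u) * dist z x) + t * dist w y"
    by (simp add: two_point_def u)
  also have "\<dots> \<le> (1 - t) * ((1 - u) * dist z x) + t * ((1 - u) * dist z y + u * a)"
    using t conv[of y] by (intro add_left_mono mult_left_mono) auto
  also have "\<dots> = (1 - u) * two_point t x y z + u * (t * a)"
    using assms(1) by (simp add: two_point_def algebra_simps)
  also have "\<dots> \<le> (1 - u) * two_point t x y z + u * two_point t x y z"
    using u x_side_ge[OF assms(1)] by (intro add_left_mono mult_left_mono) auto
  also have "\<dots> = two_point t x y z" by (simp add: algebra_simps)
  finally show "w \<in> F s" using assms(2) by (simp add: F_def)
qed

text \<open>On this side the function is the distance to \<open>y\<close>, which decreases along the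
  segment.\<close>

lemma y_side_component:
  assumes "dist z y < dist z x" "z \<in> F s"
  shows "path_component (F s) z y"
proof (rule segment_component, rule subsetI)
  fix w assume "w \<in> closed_segment z y"
  then obtain u where u: "0 \<le> u" "u \<le> 1" "dist w y = (1 - u) * dist z y" "dist w z = u * dist z y"
    by (rule segment_dist) blast
  have "dist z x \<le> dist w z + dist w x" by (metis dist_commute dist_triangle)
  then have "dist w y < dist w x" using assms(1) u by (simp add: algebra_simps)
  then have "two_point t x y w = (1 - u) * dist z y" by (simp add: two_point_def u)
  also have "\<dots> \<le> dist z y" using u by (simp add: mult_left_le_one_le)
  also have "\<dots> = two_point t x y z" using assms(1) by (simp add: two_point_def)
  finally show "w \<in> F s" using assms(2) by (simp add: F_def)
qed

text \<open>On the segment from \<open>x\<close> to \<open>y\<close> the function is highest at the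
  midpoint, at level \<open>a / 2\<close>.\<close>

lemma merged:
  assumes "a / 2 \<le> s"
  shows "path_component (F s) x y"
proof (rule segment_component, rule subsetI)
  fix w assume "w \<in> closed_segment x y"
  then obtain u where u: "0 \<le> u" "u \<le> 1" "dist w y = (1 - u) * a" "dist w x = u * a"
    by (rule segment_dist) blast
  have "two_point t x y w \<le> a / 2"
  proof (cases "dist w x \<le> dist w y")
    case True
    then have "u \<le> 1 / 2" using a_pos by (simp add: u)
    then have "(1 - 2 * t) * u \<le> (1 - 2 * t) * (1 / 2)"
      using t by (intro mult_left_mono) auto
    then have "(t + (1 - 2 * t) * u) * a \<le> 1 / 2 * a"
      by (intro mult_right_mono) auto
    then show ?thesis using True by (simp add: two_point_def u algebra_simps)
  next
    case False
    then have "1 - u < u" using a_pos by (simp add: u)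
    then have "(1 - u) * a \<le> 1 / 2 * a"
      by (intro mult_right_mono) auto
    then show ?thesis using False by (simp add: two_point_def u)
  qed
  then show "w \<in> F s" using assms by (simp add: F_def)
qed

text \<open>By the intermediate value theorem every path from \<open>x\<close> to \<open>y\<close>
  meets the bisector.\<close>

lemma separated:
  assumes "s < a / 2"
  shows "\<not> path_component (F s) x y"
proof
  assume "path_component (F s) x y"
  then obtain g where g: "path g" "path_image g \<subseteq> F s" "pathstart g = x" "pathfinish g = y"
    unfolding path_component_def by blast
  define h where "h u = dist (g u) x - dist (g u) y" for u
  have "continuous_on {0..1} h"
    using g(1) unfolding h_def path_def by (intro continuous_intros)
  moreover have "h 0 \<le> 0" "0 \<le> h 1"
    using g(3,4) by (simp_all add: h_def pathstart_def pathfinish_def)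
  ultimately obtain u where u: "0 \<le> u" "u \<le> 1" "h u = 0"
    using IVT'[of h 0 0 1] by auto
  then have "g u \<in> F s" using g(2) by (auto simp: path_image_def)
  moreover have "a / 2 \<le> two_point t x y (g u)"
    using u(3) by (intro bisector_ge) (simp add: h_def)
  ultimately show False using assms by (simp add: F_def)
qed

section \<open>Ranks of the inclusions between sublevel sets\<close>

lemma rank_neg:
  assumes "r < 0"
  shows "homology_rank TYPE('f::field) 0 (F r) (F s) = 0"
  using homology_rank_0_eq_card[of "{}" "F r" "F s"] assms
  by (simp add: F_neg zero_enat_def)

text \<open>Either the part around \<open>x\<close> is not yet present at level \<open>r\<close>, or
  it has merged by level \<open>s\<close>; in both cases \<open>y\<close> represents
  everything.\<close>

lemma rank_one:
  assumes "0 \<le> r" "r \<le> s" "r < t * a \<or> a / 2 \<le> s"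
  shows "homology_rank TYPE('f::field) 0 (F r) (F s) = 1"
proof -
  have "path_component (F s) z y" if z: "z \<in> F r" for z
  proof (cases "dist z x \<le> dist z y")
    case True
    then have "t * a \<le> r" using x_side_ge[OF True] z by (simp add: F_def)
    then have "path_component (F s) x y" using assms(3) merged by auto
    with x_side_component[OF True, of s] z F_mono[OF assms(2)] show ?thesis
      by (meson path_component_trans subsetD)
  next
    case False
    then show ?thesis using y_side_component[of z s] z F_mono[OF assms(2)] by auto
  qed
  then show ?thesis
    using homology_rank_0_eq_card[of "{y}" "F r" "F s"] assms F_mono[OF assms(2)] y_in
    by (simp add: one_enat_def)
qed

lemma rank_two:
  assumes "t * a \<le> r" "r \<le> s" "s < a / 2"
  shows "homology_rank TYPE('f::field) 0 (F r) (F s) = 2"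
proof -
  have "0 \<le> t * a" using t by simp
  then have "0 \<le> r" using assms by linarith
  have F: "F r \<subseteq> F s" by (rule F_mono[OF assms(2)])
  have "homology_rank TYPE('f::field) 0 (F r) (F s) = enat (card {x, y})"
  proof (rule homology_rank_0_eq_card[OF _ _ F])
    show "{x, y} \<subseteq> F r"
      using x_in y_in assms(1) \<open>0 \<le> r\<close> by blast
    show "\<exists>v\<in>{x, y}. path_component (F s) z v" if "z \<in> F r" for z
      using x_side_component[of z s] y_side_component[of z s] that F
      by (metis insertI1 insertI2 linorder_not_less subsetD)
    show "v = w" if "v \<in> {x, y}" "w \<in> {x, y}" "path_component (F s) v w" for v w
      using that separated[OF assms(3)] path_component_sym[of "F s" y x] by auto
  qed simp
  then show ?thesis using distinct by (simp add: numeral_eq_enat)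
qed

section \<open>Birth-death pairs of the two-point filtration\<close>

lemma diagram_point: "persistence_diagram TYPE('f::field) 0 F (t * a, ereal (a / 2)) \<noteq> 0"
proof -
  let ?R = "\<lambda>r s. persistence_rank TYPE('f) 0 F r s"
  have ta: "0 \<le> t * a" "t * a < a / 2"
    using t a_pos by (auto simp: field_simps)
  have "1 \<le> rectangle_measure TYPE('f) 0 F a1 a2 c1 c2"
    if h: "a1 < ereal (t * a)" "ereal (t * a) < a2" "a2 < c1" "c1 < ereal (a / 2)"
      "ereal (a / 2) < c2" for a1 a2 c1 c2
  proof -
    obtain r2 where r2: "a2 = ereal r2" "t * a < r2"
      using h by (cases a2) auto
    obtain s1 where s1: "c1 = ereal s1" "r2 < s1" "s1 < a / 2"
      using h r2 by (cases c1) auto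
    have two: "?R a2 c1 = 2"
      using rank_two[of r2 s1, where 'f='f] r2 s1 by (simp add: persistence_rank_def)
    \<comment> \<open>Beyond \<open>a / 2\<close> the parts have merged; at infinity the convention
      of \<open>persistence_rank\<close> gives 0.\<close>
    have R: "?R a2 c2 = (if c2 = \<infinity> then 0 else 1)"
    proof (cases c2)
      case (real s2)
      then show ?thesis
        using rank_one[of r2 s2, where 'f='f] r2 s1 ta h(5) by (simp add: persistence_rank_def)
    qed (use h in \<open>auto simp: persistence_rank_def\<close>)
    \<comment> \<open>Below level 0 the ranks from \<open>a1\<close> vanish and the measure is at
      least \<open>2 - 1\<close>. Otherwise the first difference is \<open>2 - 1\<close> and the
      second one is 0.\<close>
    consider "a1 = -\<infinity>" | r1 where "a1 = ereal r1" "r1 < 0" 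
      | r1 where "a1 = ereal r1" "0 \<le> r1" "r1 < t * a"
      using h(1) by (cases a1) (auto simp: not_le[symmetric])
    then show ?thesis
    proof cases
      case 1
      then show ?thesis
        using two R by (auto simp: rectangle_measure_def persistence_rank_def one_enat_def numeral_eq_enat)
    next
      case 2
      then have "?R a1 c1 = 0" "?R a1 c2 = 0"
        by (auto simp: persistence_rank_def rank_neg)
      then show ?thesis
        using two R by (auto simp: rectangle_measure_def one_enat_def numeral_eq_enat)
    next
      case 3
      then have "?R a1 c1 = 1"
        using rank_one[of r1 s1, where 'f='f] s1 r2 by (simp add: persistence_rank_def)
      moreover have "?R a1 c2 = ?R a2 c2"
        using 3 R rank_one[of r1 "real_of_ereal c2", where 'f='f] h(5) ta
        by (cases c2) (auto simp: persistence_rank_def)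
      ultimately show ?thesis
        using two R by (auto simp: rectangle_measure_def one_enat_def numeral_eq_enat)
    qed
  qed
  then have "1 \<le> persistence_diagram TYPE('f) 0 F (t * a, ereal (a / 2))"
    using ta unfolding persistence_diagram_def by (auto intro!: Inf_greatest)
  then show ?thesis by auto
qed

text \<open>For \<open>t = 0\<close> both parts exist from level 0 on. Ranks from positive levels
  then depend only on the second level, so a point of positive birth lies in a rectangle of measure
  0.\<close>

lemma diagram_birth_nonpos:
  assumes "t = 0" and nz: "persistence_diagram TYPE('f::field) 0 F (b, d) \<noteq> 0"
  shows "b \<le> 0"
proof (rule ccontr)
  assume "\<not> b \<le> 0"
  then have b: "b > 0" by simp
  let ?R = "\<lambda>r s. persistence_rank TYPE('f) 0 F r s"
  have bd: "ereal b < d"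
    using nz by (auto simp: persistence_diagram_def split: if_splits)
  obtain r2 where r2: "b < r2" "ereal r2 < d"
    using ereal_dense2[OF bd] by auto
  obtain s1 where s1: "r2 < s1" "ereal s1 < d"
    using ereal_dense2[OF r2(2)] by auto
  \<comment> \<open>This exceeds a real \<open>d\<close> and stays infinite for infinite
    \<open>d\<close>, as the definition of the diagram requires.\<close>
  define c2 where "c2 = d + 1"
  have c2: "d < c2 \<or> d = \<infinity> \<and> c2 = \<infinity>"
    using bd unfolding c2_def by (cases d) auto
  have "?R (ereal r2) (ereal s1) = ?R (ereal (b / 2)) (ereal s1)"
    using rank_one[of r2 s1, where 'f='f] rank_one[of "b/2" s1, where 'f='f]
      rank_two[of r2 s1, where 'f='f] rank_two[of "b/2" s1, where 'f='f] b r2 s1 assms(1)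
    by (cases "s1 < a / 2") (auto simp: persistence_rank_def)
  \<comment> \<open>Finiteness matters because
    \<open>\<infinity> - \<infinity> = \<infinity>\<close> in \<open>enat\<close>. Once the first
    difference is 0, truncation makes the measure 0 for any \<open>c2\<close>.\<close>
  moreover have "?R (ereal r2) (ereal s1) \<noteq> \<infinity>"
    using rank_one[of r2 s1, where 'f='f] rank_two[of r2 s1, where 'f='f] b r2 s1 assms(1)
    by (cases "s1 < a / 2") (auto simp: persistence_rank_def)
  ultimately have "rectangle_measure TYPE('f) 0 F (ereal (b / 2)) (ereal r2) (ereal s1) c2 = 0"
    by (auto simp: rectangle_measure_def)
  moreover have "ereal (b / 2) < ereal b" "ereal b < ereal r2" "ereal r2 < ereal s1"
    using b r2 s1 by auto
  ultimately have "Inf {rectangle_measure TYPE('f) 0 F a1 a2 c1 c2 | a1 a2 c1 c2.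
      a1 < ereal b \<and> ereal b < a2 \<and> a2 < c1 \<and> c1 < d \<and> (d < c2 \<or> d = \<infinity> \<and> c2 = \<infinity>)} \<le> 0"
    using s1(2) c2 by (intro Inf_lower CollectI) metis
  then have "persistence_diagram TYPE('f) 0 F (b, d) \<le> 0"
    using bd unfolding persistence_diagram_def by simp
  then show False using nz by simp
qed

end

section \<open>Distance to measure and diagrams of two-valued data\<close>

lemma sort_key_two_values:
  "sort_key f (replicate i x @ replicate j y) =
     (if f x \<le> f y then replicate i x @ replicate j y else replicate j y @ replicate i x)"
  by (rule properties_for_sort_key) (auto simp: sorted_append)

text \<open>By \<open>j \<le> k\<close> all copies of \<open>x\<close> count when \<open>x\<close>
  is nearer, and by \<open>j + k \<le> n\<close> there are \<open>k\<close> copies of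
  \<open>y\<close> when \<open>y\<close> is nearer.\<close>

lemma dtm_two_points:
  fixes x y z :: "'a::real_normed_vector"
  assumes k: "k = nat \<lceil>m * real n\<rceil>" "0 < k" "j \<le> k" "j + k \<le> n"
  shows "dtm m (replicate j x @ replicate (n - j) y) z
       = two_point (1 - real j / real k) x y z"
proof -
  let ?D = "replicate j x @ replicate (n - j) y"
  have len: "length ?D = n" using k by simp
  have "nearest_neighbours ?D k z =
     (if dist z x \<le> dist z y then replicate j x @ replicate (k - j) y else replicate k y)"
    using k by (auto simp: nearest_neighbours_def sort_key_two_values dist_norm norm_minus_commute)
  then show ?thesis
    unfolding dtm_def len Let_def k(1)[symmetric] two_point_def using k(2,3)
    by (auto simp: sum_list_replicate dist_norm norm_minus_commute field_simps of_nat_diff)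
qed


text \<open>The first diagram has a point born at \<open>t * dist x y\<close> with
  \<open>t = l / k\<close>, whereas all births in the second one are at most 0.\<close>

lemma bottleneck_dtm_two_points:
  fixes x y :: "'a::real_normed_vector"
  assumes k: "k = nat \<lceil>m * real n\<rceil>" "0 < k" "2 * k \<le> n" and l: "6 * l \<le> k" and xy: "x \<noteq> y"
  shows "ereal (real l / real k * dist x y)
     \<le> bottleneck (dtm_diagram TYPE('f::field) 0 m (replicate (k - l) x @ replicate (n - (k - l)) y))
          (dtm_diagram TYPE('f) 0 m (replicate k x @ replicate (n - k) y))"
proof -
  define t where "t = real l / real k"
  have t6: "0 \<le> t" "6 * t \<le> 1"
    using k(2) l by (auto simp: t_def field_simps)
  have "1 - real (k - l) / real k = t"
    using k(2) l by (simp add: t_def of_nat_diff field_simps)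
  then have P: "dtm_diagram TYPE('f) 0 m (replicate (k - l) x @ replicate (n - (k - l)) y)
      = persistence_diagram TYPE('f) 0 (\<lambda>r. {z. two_point t x y z \<le> r})"
    unfolding dtm_diagram_def using dtm_two_points[OF k(1,2), of "k - l" x y] k(3) by simp
  have Q: "dtm_diagram TYPE('f) 0 m (replicate k x @ replicate (n - k) y)
      = persistence_diagram TYPE('f) 0 (\<lambda>r. {z. two_point 0 x y z \<le> r})"
    unfolding dtm_diagram_def using dtm_two_points[OF k(1,2), of k x y] k(2,3) by simp
  interpret P: two_point_sublevels t x y "\<lambda>r. {z. two_point t x y z \<le> r}"
    by unfold_locales (use t6 xy in auto)
  interpret Q: two_point_sublevels 0 x y "\<lambda>r. {z. two_point 0 x y z \<le> r}"
    by unfold_locales (use xy in auto)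
  have "ereal (t * dist x y) \<le> bottleneck
      (persistence_diagram TYPE('f) 0 (\<lambda>r. {z. two_point t x y z \<le> r}))
      (persistence_diagram TYPE('f) 0 (\<lambda>r. {z. two_point 0 x y z \<le> r}))"
  proof (rule bottleneck_ge_of_missing_birth)
    show "persistence_diagram TYPE('f) 0 (\<lambda>r. {z. two_point t x y z \<le> r})
        (t * dist x y, ereal (dist x y / 2)) \<noteq> 0"
      by (rule P.diagram_point)
    \<comment> \<open>This is where \<open>6 * l \<le> k\<close> enters: the persistence
      \<open>(1 / 2 - t) * dist x y\<close> is at least twice the gap between the births.\<close>
    have "6 * t * dist x y \<le> 1 * dist x y"
      using t6 by (intro mult_right_mono) auto
    then show "t * dist x y + 2 * (t * dist x y) \<le> dist x y / 2" by simp
  qed (use Q.diagram_birth_nonpos in auto)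
  then show ?thesis unfolding P Q by (simp add: t_def)
qed

lemma hamming_two_points_Suc:
  "hamming (replicate j x @ replicate (n - j) y) (replicate (Suc j) x @ replicate (n - Suc j) y) \<le> 1"
proof -
  have "{i. i < length (replicate j x @ replicate (n - j) y) \<and>
      (replicate j x @ replicate (n - j) y) ! i \<noteq> (replicate (Suc j) x @ replicate (n - Suc j) y) ! i}
      \<subseteq> {j}" (is "?I \<subseteq> _")
  proof
    fix i assume "i \<in> ?I"
    then show "i \<in> {j}"
      by (cases i j rule: linorder_cases) (auto simp: nth_append simp del: replicate_Suc)
  qed
  from card_mono[OF _ this] show ?thesis by (simp add: hamming_def)
qed

section \<open>Differential privacy\<close>

text \<open>Each step of the chain of neighbouring data sets costs one factor
  \<open>exp \<epsilon>\<close>.\<close>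

lemma group_privacy:
  assumes dp: "differentially_private \<epsilon> E n Y \<Omega> M"
    and D: "\<And>i. i \<le> l \<Longrightarrow> D i \<in> datasets n E"
    and step: "\<And>i. i < l \<Longrightarrow> hamming (D i) (D (Suc i)) \<le> 1"
    and S: "S \<in> sets Y"
  shows "measure (\<Omega> (D 0)) {\<omega> \<in> space (\<Omega> (D 0)). M (D 0) \<omega> \<in> S}
      \<le> exp (real l * \<epsilon>) * measure (\<Omega> (D l)) {\<omega> \<in> space (\<Omega> (D l)). M (D l) \<omega> \<in> S}"
  using D step
proof (induction l)
  case 0
  then show ?case by simp
next
  case (Suc l)
  let ?p = "\<lambda>i. measure (\<Omega> (D i)) {\<omega> \<in> space (\<Omega> (D i)). M (D i) \<omega> \<in> S}"
  have "?p 0 \<le> exp (real l * \<epsilon>) * ?p l"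
    by (rule Suc.IH) (use Suc.prems in auto)
  also have "?p l \<le> exp \<epsilon> * ?p (Suc l)"
    using dp S Suc.prems(1)[of l] Suc.prems(1)[of "Suc l"] Suc.prems(2)[of l]
    unfolding differentially_private_def by simp
  then have "exp (real l * \<epsilon>) * ?p l \<le> exp (real l * \<epsilon>) * (exp \<epsilon> * ?p (Suc l))"
    by (rule mult_left_mono) simp
  also have "\<dots> = exp (real (Suc l) * \<epsilon>) * ?p (Suc l)"
    by (simp add: exp_add[symmetric] algebra_simps)
  finally show ?case .
qed

text \<open>Clears the quotient and the absolute value. The events agree only eventually, as
  \<open>a\<close> is known to be positive only from index 1 on.\<close>

lemma small_op_imp_tendsto:
  assumes "small_op \<Omega> X a" "\<eta> > 0"
    and a: "\<And>n. n \<ge> 1 \<Longrightarrow> a n > 0" and X: "\<And>n \<omega>. 0 \<le> X n \<omega>"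
  shows "(\<lambda>n. measure (\<Omega> n) {\<omega> \<in> space (\<Omega> n). X n \<omega> > ereal (\<eta> * a n)}) \<longlonglongrightarrow> 0"
proof -
  have "(\<lambda>n. measure (\<Omega> n) {\<omega> \<in> space (\<Omega> n). \<bar>X n \<omega> / ereal (a n)\<bar> > ereal \<eta>}) \<longlonglongrightarrow> 0"
    using assms(1,2) by (simp add: small_op_def)
  moreover have "\<forall>\<^sub>F n in sequentially.
      measure (\<Omega> n) {\<omega> \<in> space (\<Omega> n). \<bar>X n \<omega> / ereal (a n)\<bar> > ereal \<eta>}
    = measure (\<Omega> n) {\<omega> \<in> space (\<Omega> n). X n \<omega> > ereal (\<eta> * a n)}"
    using eventually_ge_at_top[of 1]
  proof eventually_elim
    case (elim n)
    have "\<bar>X n \<omega> / ereal (a n)\<bar> > ereal \<eta> \<longleftrightarrow> X n \<omega> > ereal (\<eta> * a n)" for \<omega>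
      using X[of n \<omega>] a[OF elim] by (cases "X n \<omega>") (auto simp: field_simps)
    then show ?case by simp
  qed
  ultimately show ?thesis by (rule Lim_transform_eventually)
qed

section \<open>Separation of the diagrams against privacy of the mechanism\<close>

theorem theorem18:
  fixes E :: "(real ^ 'd) set"
    and m :: real
    and \<epsilon> :: "nat \<Rightarrow> real"
    and \<Omega> :: "nat \<Rightarrow> (real ^ 'd) list \<Rightarrow> 'w measure"
    and M :: "nat \<Rightarrow> (real ^ 'd) list \<Rightarrow> 'w \<Rightarrow> diagram"
  assumes "bounded E" and "diameter E > 0"
    and "0 < m" and "m < 1 / 2"
    and "\<And>n. n \<ge> 1 \<Longrightarrow> 1 / real n \<le> \<epsilon> n \<and> \<epsilon> n \<le> 1"
    and "\<And>n. n \<ge> 1 \<Longrightarrow> mechanism E n diagram_borel (\<Omega> n) (M n)"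
    and "\<And>n. n \<ge> 1 \<Longrightarrow> differentially_private (\<epsilon> n) E n diagram_borel (\<Omega> n) (M n)"
  shows "\<not> (\<forall>D. (\<forall>n\<ge>1. D n \<in> datasets n E) \<longrightarrow>
              small_op (\<lambda>n. \<Omega> n (D n))
                (\<lambda>n \<omega>. bottleneck (dtm_diagram TYPE('f::field) 0 m (D n)) (M n (D n) \<omega>))
                (\<lambda>n. 1 / (real n * \<epsilon> n)))"
proof
  note m = \<open>0 < m\<close> \<open>m < 1 / 2\<close> and \<epsilon> = assms(5) and mech = assms(6) and dp = assms(7)
  assume small: "\<forall>D. (\<forall>n\<ge>1. D n \<in> datasets n E) \<longrightarrow>
              small_op (\<lambda>n. \<Omega> n (D n))
                (\<lambda>n \<omega>. bottleneck (dtm_diagram TYPE('f::field) 0 m (D n)) (M n (D n) \<omega>))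
                (\<lambda>n. 1 / (real n * \<epsilon> n))"
  obtain x y where xy: "x \<in> E" "y \<in> E" "x \<noteq> y"
  proof -
    have "\<not> (\<exists>a. E \<subseteq> {a})"
      using \<open>diameter E > 0\<close> by (metis diameter_empty diameter_singleton less_irrefl subset_singletonD)
    then show ?thesis using that by blast
  qed
  have \<epsilon>_pos: "\<epsilon> n > 0" if "n \<ge> 1" for n
    using \<epsilon>[OF that] that by (smt (verit) divide_pos_pos of_nat_0_less_iff zero_less_one_class.zero_less_one less_le_trans not_less)
  define k where "k n = nat \<lceil>m * real n\<rceil>" for n
  \<comment> \<open>Then \<open>l / k\<close> is at least
    \<open>m / (12 * n * \<epsilon> n)\<close>, because \<open>k \<le> n\<close>. Since
    \<open>1 / \<epsilon> n \<le> n\<close>, also \<open>6 * l \<le> m * n / 2 + 6 \<le> k\<close>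
    as soon as \<open>m * n \<ge> 12\<close>.\<close>
  define l where "l n = nat \<lceil>m / 12 / \<epsilon> n\<rceil>" for n
  define D where "D n j = replicate j x @ replicate (n - j) y" for n j
  \<comment> \<open>Twice this constant is \<open>m * dist x y / 18\<close>, strictly below the
    separation constant \<open>m * dist x y / 12\<close>.\<close>
  define \<eta> where "\<eta> = m * dist x y / 36"
  have \<eta>: "\<eta> > 0" using m xy by (simp add: \<eta>_def)
  have k_n: "k n \<le> n" for n
  proof -
    have "m * real n \<le> 1 * real n" using m by (intro mult_right_mono) auto
    then show ?thesis by (simp add: k_def nat_le_iff ceiling_le_iff)
  qed
  have D_in: "D n j \<in> datasets n E" if "j \<le> n" for n j
    using that xy by (auto simp: D_def datasets_def)
  define dg where "dg n j = dtm_diagram TYPE('f) 0 m (D n j)" for n j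
  define far where "far n j = {R \<in> diagrams. bottleneck (dg n j) R > ereal (\<eta> / (real n * \<epsilon> n))}" for n j
  define p where "p n j S = measure (\<Omega> n (D n j)) {\<omega> \<in> space (\<Omega> n (D n j)). M n (D n j) \<omega> \<in> S}" for n j S
  have far_sets: "far n j \<in> sets diagram_borel" for n j
    unfolding far_def by (rule bottleneck_far_in_sets)
  \<comment> \<open>The number of copies of \<open>x\<close> may vary with \<open>n\<close>, since
    the assumption covers every sequence of data sets.\<close>
  have p_far: "(\<lambda>n. p n (j n) (far n (j n))) \<longlonglongrightarrow> 0" if j: "\<And>n. j n \<le> n" for j
  proof -
    have "(\<lambda>n. measure (\<Omega> n (D n (j n))) {\<omega> \<in> space (\<Omega> n (D n (j n))).
        bottleneck (dg n (j n)) (M n (D n (j n)) \<omega>) > ereal (\<eta> * (1 / (real n * \<epsilon> n)))}) \<longlonglongrightarrow> 0"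
      unfolding dg_def
      by (rule small_op_imp_tendsto)
         (use small j D_in \<eta> \<epsilon>_pos in \<open>auto simp: bottleneck_nonneg\<close>)
    moreover have "\<forall>\<^sub>F n in sequentially.
      measure (\<Omega> n (D n (j n))) {\<omega> \<in> space (\<Omega> n (D n (j n))).
        bottleneck (dg n (j n)) (M n (D n (j n)) \<omega>) > ereal (\<eta> * (1 / (real n * \<epsilon> n)))}
      = p n (j n) (far n (j n))"
      using eventually_ge_at_top[of 1]
    proof eventually_elim
      case (elim n)
      have meas: "M n (D n (j n)) \<in> measurable (\<Omega> n (D n (j n))) diagram_borel"
        using mech[OF elim] D_in[OF j] by (simp add: mechanism_def)
      have "M n (D n (j n)) \<omega> \<in> diagrams" if "\<omega> \<in> space (\<Omega> n (D n (j n)))" for \<omega>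
        using measurable_space[OF meas that] by simp
      then show ?case
        unfolding p_def far_def by (intro arg_cong[where f = "measure _"]) auto
    qed
    ultimately show ?thesis by (rule Lim_transform_eventually)
  qed
  \<comment> \<open>Every output is far from at least one of the two diagrams. The union bound is
    taken under the law for \<open>k - l\<close> copies, and group privacy moves the second event to
    the law for \<open>k\<close> copies.\<close>
  have ineq: "1 \<le> p n (k n - l n) (far n (k n - l n)) + exp 2 * p n (k n) (far n (k n))"
    if n1: "n \<ge> 1" and n_large: "real n \<ge> 12 / m" "real n \<ge> 2 / (1 - 2 * m)" for n
  proof -
    note \<epsilon>0 = \<epsilon>_pos[OF n1]
    have mn: "m * real n \<ge> 12" using n_large(1) m by (simp add: field_simps)
    have k_ge: "m * real n \<le> real (k n)" and k_le: "real (k n) \<le> m * real n + 1"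
      using mn by (simp_all add: k_def)
    have k0: "0 < k n" using k_ge mn by (cases "k n") auto
    \<comment> \<open>The rounding in \<open>k\<close> costs at most 2 here, which
      \<open>n \<ge> 2 / (1 - 2 * m)\<close> absorbs.\<close>
    have "2 * real (k n) \<le> real n"
      using k_le n_large(2) m by (simp add: field_simps)
    then have k2: "2 * k n \<le> n" by linarith
    have l_nonneg: "0 \<le> m / 12 / \<epsilon> n" using m \<epsilon>0 by simp
    have l_ge: "m / 12 / \<epsilon> n \<le> real (l n)" and l_le: "real (l n) \<le> m / 12 / \<epsilon> n + 1"
      using l_nonneg by (simp_all add: l_def)
    have "1 / \<epsilon> n \<le> real n"
      using \<epsilon>[OF n1] \<epsilon>0 n1 by (simp add: field_simps)
    then have "m / 12 * (1 / \<epsilon> n) \<le> m / 12 * real n"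
      using m by (intro mult_left_mono) auto
    then have "real (l n) \<le> m * real n / 12 + 1" using l_le by simp
    then have "6 * real (l n) \<le> real (k n)" using k_ge mn by simp
    then have l6: "6 * l n \<le> k n" by linarith
    \<comment> \<open>This keeps the privacy factor below the constant \<open>exp 2\<close>;
      rounding up in \<open>l\<close> contributes one \<open>\<epsilon> n \<le> 1\<close>.\<close>
    have "real (l n) * \<epsilon> n \<le> (m / 12 / \<epsilon> n + 1) * \<epsilon> n"
      using l_le \<epsilon>0 by (intro mult_right_mono) auto
    also have "\<dots> = m / 12 + \<epsilon> n" using \<epsilon>0 by (simp add: field_simps)
    also have "\<dots> \<le> 2" using m \<epsilon>[OF n1] by simp
    finally have l\<epsilon>: "real (l n) * \<epsilon> n \<le> 2" .
    let ?\<delta> = "\<eta> / (real n * \<epsilon> n)"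
    have "?\<delta> + ?\<delta> < real (l n) / real (k n) * dist x y"
    proof -
      have "?\<delta> + ?\<delta> = m * dist x y / 18 / (real n * \<epsilon> n)" by (simp add: \<eta>_def)
      also have "\<dots> < m * dist x y / 12 / (real n * \<epsilon> n)"
        using m xy \<epsilon>0 n1 by (intro divide_strict_right_mono) auto
      also have "\<dots> = m / 12 / \<epsilon> n / real n * dist x y" by simp
      also have "\<dots> \<le> real (l n) / real (k n) * dist x y"
        using l_ge k_n k0 by (intro mult_right_mono frac_le) auto
      finally show ?thesis .
    qed
    then have sep: "ereal (?\<delta> + ?\<delta>) < bottleneck (dg n (k n - l n)) (dg n (k n))"
      using bottleneck_dtm_two_points[OF k_def[of n] k0 k2 l6 xy(3), where 'f='f]
      unfolding dg_def D_def by (meson less_ereal.simps(1) less_le_trans)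
    have near: "R \<in> far n (k n)" if "R \<in> diagrams" "R \<notin> far n (k n - l n)" for R
    proof (rule ccontr)
      assume "R \<notin> far n (k n)"
      then have le: "bottleneck (dg n (k n - l n)) R \<le> ereal ?\<delta>" "bottleneck (dg n (k n)) R \<le> ereal ?\<delta>"
        using that by (auto simp: far_def)
      \<comment> \<open>The triangle inequality needs strict bounds, so the weak bounds on the
        distances are relaxed to \<open>c / 2\<close>, with \<open>c\<close> still below the
        separation.\<close>
      obtain c where c: "?\<delta> + ?\<delta> < c" "ereal c < bottleneck (dg n (k n - l n)) (dg n (k n))"
        using ereal_dense2[OF sep] by auto
      have half: "ereal u < ereal (v / 2)" if "u + u < v" for u v :: real
        using that by simp
      note half[OF c(1)]
      with le have "bottleneck (dg n (k n - l n)) R < ereal (c / 2)" "bottleneck (dg n (k n)) R < ereal (c / 2)"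
        by (meson le_less_trans)+
      from bottleneck_triangle_less[OF this(1) bottleneck_less_swap[OF this(2)]] c(2)
      show False by simp
    qed
    let ?j = "k n - l n"
    have j_n: "?j \<le> n" using k_n[of n] by simp
    interpret prob_space "\<Omega> n (D n ?j)"
      using mech[OF n1] D_in[OF j_n] by (simp add: mechanism_def)
    have meas: "M n (D n ?j) \<in> measurable (\<Omega> n (D n ?j)) diagram_borel"
      using mech[OF n1] D_in[OF j_n] by (simp add: mechanism_def)
    let ?ev = "\<lambda>S. {\<omega> \<in> space (\<Omega> n (D n ?j)). M n (D n ?j) \<omega> \<in> S}"
    have ev: "?ev S \<in> events" if "S \<in> sets diagram_borel" for S
      using measurable_sets[OF meas that] by (simp add: vimage_def Int_def conj_commute)
    have "space (\<Omega> n (D n ?j)) = ?ev (far n ?j) \<union> ?ev (far n (k n))"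
      using near measurable_space[OF meas] by auto
    then have "1 = prob (?ev (far n ?j) \<union> ?ev (far n (k n)))"
      using prob_space by simp
    also have "\<dots> \<le> p n ?j (far n ?j) + p n ?j (far n (k n))"
      unfolding p_def by (rule measure_Un_le) (intro ev far_sets)+
    also have "p n ?j (far n (k n)) \<le> exp (real (l n) * \<epsilon> n) * p n (k n) (far n (k n))"
    proof -
      have l_k: "l n \<le> k n" using l6 by simp
      \<comment> \<open>The chain adds one copy of \<open>x\<close> at a time and reaches
        \<open>k n\<close> copies after \<open>l n\<close> steps.\<close>
      have "hamming (D n (?j + i)) (D n (?j + Suc i)) \<le> 1" for i
        using hamming_two_points_Suc[of "?j + i" x n y] by (simp add: D_def)
      moreover have "D n (?j + i) \<in> datasets n E" if "i \<le> l n" for i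
        using that l_k k_n[of n] by (intro D_in) linarith
      ultimately show ?thesis
        using group_privacy[OF dp[OF n1], of "l n" "\<lambda>i. D n (?j + i)" "far n (k n)"] far_sets l_k
        by (simp add: p_def)
    qed
    also have "exp (real (l n) * \<epsilon> n) * p n (k n) (far n (k n)) \<le> exp 2 * p n (k n) (far n (k n))"
      using l\<epsilon> by (intro mult_right_mono) (auto simp: p_def)
    finally show ?thesis by simp
  qed
  \<comment> \<open>Both probabilities vanish in the limit, although their weighted sum is
    eventually at least 1.\<close>
  have "(\<lambda>n. p n (k n - l n) (far n (k n - l n)) + exp 2 * p n (k n) (far n (k n))) \<longlonglongrightarrow> 0 + exp 2 * 0"
    by (intro tendsto_intros p_far) (use k_n le_trans diff_le_self in blast)+
  moreover have "\<forall>\<^sub>F n in sequentially.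
      1 \<le> p n (k n - l n) (far n (k n - l n)) + exp 2 * p n (k n) (far n (k n))"
    using eventually_ge_at_top[of 1]
      filterlim_real_sequentially[unfolded filterlim_at_top, rule_format, of "12 / m"]
      filterlim_real_sequentially[unfolded filterlim_at_top, rule_format, of "2 / (1 - 2 * m)"]
    by eventually_elim (rule ineq)
  ultimately have "(1::real) \<le> 0 + exp 2 * 0"
    by (rule tendsto_lowerbound) simp
  then show False by simp
qed

end
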